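(* Let $N\ge1$, $1<p<\infty$, $0<s<1$, let $\Omega\subset\mathbb{R}^N$ be a bounded open set with Lipschitz boundary, and assume that $\mathrm{diam}(\Omega)<e^{-\frac1{sp}}$ and $B(N,s,p)\ge0$. Let $\lambda\in\mathbb{R}$ and let $u\in W^{s+\log,p}_0(\Omega)$ satisfy $$\mathcal{J}_{s+\log,p}(u,\varphi)=\lambda\int_\Omega|u|^{p-2}u\,\varphi\,dx\qquad\text{for all }\varphi\in W^{s+\log,p}_0(\Omega).$$ Then $u\in L^\infty(\Omega)$.
   Context: Notation: $\mathrm{diam}(\Omega)=\sup\{|x-y|:x,y\in\Omega\}$; $(a)_\pm=\max\{0,\pm a\}$; $\psi=\Gamma'/\Gamma$; $$C(N,s,p)=\begin{cases}\dfrac{s\,p\,2^{2(s-1)}\,\Gamma\left(\frac{N+sp}{2}\right)}{\pi^{\frac{N-1}{2}}\,\Gamma(1-s)\,\Gamma\left(\frac{p+1}{2}\right)}, & s>\tfrac12,\\[8pt]\dfrac{s\,p\,2^{2s-1}\,\Gamma\left(\frac{N+sp}{2}\right)}{\pi^{\frac N2}\,\Gamma(1-s)}, & s\le\tfrac12,\end{cases}\qquad B(N,s,p)=2\ln2+\frac1s+\frac p2\psi\Big(\frac{N+sp}{2}\Big)+\psi(1-s).$$ Kernels: $\mathbf{k}^{s+\log,\pm}_p(z):=\dfrac{C(N,s,p)(-\ln|z|)_\pm}{|z|^{N+sp}}$, $z\in\mathbb{R}^N\setminus\{0\}$. $W^{s+\log,p}_0(\Omega)$ is the space of real-valued $u\in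 L^p(\mathbb{R}^N)$ with $u=0$ a.e. in $\mathbb{R}^N\setminus\Omega$ and $\iint_{\mathbb{R}^{2N}}|u(x)-u(y)|^p\mathbf{k}^{s+\log,+}_p(x-y)\,dx\,dy<\infty$. Energy forms: $$\mathcal{J}_\pm(u,v)=\iint_{\mathbb{R}^{2N}}|u(x)-u(y)|^{p-2}(u(x)-u(y))(v(x)-v(y))\,\mathbf{k}^{s+\log,\pm}_p(x-y)\,dx\,dy,$$ $$\mathcal{J}_s(u,v)=\iint_{\mathbb{R}^{2N}}\frac{|u(x)-u(y)|^{p-2}(u(x)-u(y))(v(x)-v(y))}{|x-y|^{N+sp}}\,dx\,dy,$$ $$\mathcal{J}_{s+\log,p}(u,v)=\frac p2\big(\mathcal{J}_+(u,v)-\mathcal{J}_-(u,v)\big)+\frac{B(N,s,p)C(N,s,p)}{2}\mathcal{J}_s(u,v).$$ *)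

theory Defs
  imports "HOL-Analysis.Analysis"
begin

text \<open>
  The ambient space \<open>\<real>\<^sup>N\<close> is a type of class \<open>euclidean_space\<close>, with \<open>N = DIM('a)\<close>, and
  \<open>\<real>\<^sup>2\<^sup>N\<close> is the product \<open>'a \<times> 'a\<close> with its own Lebesgue measure.  Elements of \<open>L\<^sup>p\<close> are
  Lebesgue measurable functions rather than equivalence classes.
\<close>

text \<open>
  Near each boundary point the set is, in suitably rotated coordinates, the strict epigraph of a
  Lipschitz function of the remaining \<open>N - 1\<close> coordinates: \<open>e\<close> is the last coordinate direction
  and the hyperplane orthogonal to \<open>e\<close> plays the role of \<open>\<real>\<^sup>N\<^sup>-\<^sup>1\<close>.
\<close>

definition lipschitz_boundary :: "'a::euclidean_space set \<Rightarrow> bool" where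
  "lipschitz_boundary \<Omega> \<longleftrightarrow>
     (\<forall>x0 \<in> frontier \<Omega>. \<exists>r>0. \<exists>e. \<exists>g :: 'a \<Rightarrow> real. \<exists>L.
        norm e = 1 \<and> L-lipschitz_on {y. y \<bullet> e = 0} g \<and>
        \<Omega> \<inter> ball x0 r = {x \<in> ball x0 r. g (x - (x \<bullet> e) *\<^sub>R e) < x \<bullet> e})"

definition C_const :: "nat \<Rightarrow> real \<Rightarrow> real \<Rightarrow> real" where
  "C_const N s p =
     (if s > 1/2
      then s * p * 2 powr (2 * (s - 1)) * Gamma ((real N + s * p) / 2)
           / (pi powr ((real N - 1) / 2) * Gamma (1 - s) * Gamma ((p + 1) / 2))
      else s * p * 2 powr (2 * s - 1) * Gamma ((real N + s * p) / 2)
           / (pi powr (real N / 2) * Gamma (1 - s)))"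

definition B_const :: "nat \<Rightarrow> real \<Rightarrow> real \<Rightarrow> real" where
  "B_const N s p =
     2 * ln 2 + 1 / s + p / 2 * Digamma ((real N + s * p) / 2) + Digamma (1 - s)"

text \<open>
  The kernels are only meant for \<open>z \<noteq> 0\<close>; at \<open>z = 0\<close> they take the value \<open>0\<close> by totality
  of division, which affects only the null set \<open>x = y\<close> in the double integrals below.
\<close>

definition kernel_s :: "real \<Rightarrow> real \<Rightarrow> 'a::euclidean_space \<Rightarrow> real" where
  "kernel_s s p z = 1 / norm z powr (real DIM('a) + s * p)"

definition kernel_log_pos :: "real \<Rightarrow> real \<Rightarrow> 'a::euclidean_space \<Rightarrow> real" where
  "kernel_log_pos s p z =
     C_const DIM('a) s p * max 0 (- ln (norm z)) / norm z powr (real DIM('a) + s * p)"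

definition kernel_log_neg :: "real \<Rightarrow> real \<Rightarrow> 'a::euclidean_space \<Rightarrow> real" where
  "kernel_log_neg s p z =
     C_const DIM('a) s p * max 0 (- (- ln (norm z))) / norm z powr (real DIM('a) + s * p)"

definition Lp_space :: "real \<Rightarrow> ('a::euclidean_space \<Rightarrow> real) set" where
  "Lp_space p =
     {u \<in> borel_measurable lebesgue. integrable lebesgue (\<lambda>x. \<bar>u x\<bar> powr p)}"

definition Linf_space :: "'a::euclidean_space set \<Rightarrow> ('a \<Rightarrow> real) set" where
  "Linf_space \<Omega> =
     {u \<in> borel_measurable (lebesgue_on \<Omega>). \<exists>K. AE x in lebesgue_on \<Omega>. \<bar>u x\<bar> \<le> K}"

definition W0_slog :: "real \<Rightarrow> real \<Rightarrow> 'a::euclidean_space set \<Rightarrow> ('a \<Rightarrow> real) set" where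
  "W0_slog s p \<Omega> =
     {u \<in> Lp_space p. (AE x in lebesgue. x \<notin> \<Omega> \<longrightarrow> u x = 0) \<and>
        (\<integral>\<^sup>+ (x, y). ennreal (\<bar>u x - u y\<bar> powr p * kernel_log_pos s p (x - y))
           \<partial>(lebesgue :: ('a \<times> 'a) measure)) < \<infinity>}"

text \<open>
  For \<open>u\<close> and \<open>v\<close> in \<open>W0_slog s p \<Omega>\<close> and each of the three kernels the integrand below
  is integrable: for \<open>kernel_log_pos\<close> by Hoelder's inequality, and for the other two because they
  are bounded by a multiple of \<open>kernel_log_pos\<close> near \<open>0\<close> and are integrable away from \<open>0\<close>.
  For \<open>p < 2\<close> the expression \<open>|t|\<^sup>p\<^sup>-\<^sup>2 t\<close> is \<open>0\<close> at \<open>t = 0\<close>, as usual.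
\<close>

definition energy ::
    "real \<Rightarrow> ('a::euclidean_space \<Rightarrow> real) \<Rightarrow> ('a \<Rightarrow> real) \<Rightarrow> ('a \<Rightarrow> real) \<Rightarrow> real" where
  "energy p k u v =
     (\<integral>(x, y). \<bar>u x - u y\<bar> powr (p - 2) * (u x - u y) * (v x - v y) * k (x - y)
        \<partial>(lebesgue :: ('a \<times> 'a) measure))"

definition J_slog ::
    "real \<Rightarrow> real \<Rightarrow> ('a::euclidean_space \<Rightarrow> real) \<Rightarrow> ('a \<Rightarrow> real) \<Rightarrow> real" where
  "J_slog s p u v =
     p / 2 * (energy p (kernel_log_pos s p) u v - energy p (kernel_log_neg s p) u v)
     + B_const DIM('a) s p * C_const DIM('a) s p / 2 * energy p (kernel_s s p) u v"

end

theory Submission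
  imports Defs
begin

text \<open>
  The solution is bounded because the equation forces its level sets \<open>A k = {u > k}\<close> to become null
  at a finite \<open>k\<close>.  Testing the equation with \<open>w = (u - k)\<^sub>+\<close> controls the energy of \<open>w\<close> for the singular
  kernel by lower order terms: on \<open>\<Omega> \<times> \<Omega>\<close> the kernel is nonnegative, because distances in
  \<open>\<Omega>\<close> are at most \<open>1\<close> and \<open>B \<ge> 0\<close>, and its negative part, which only couples \<open>\<Omega>\<close> with its
  complement, acts as a bounded potential since it has finite mass
  (\<open>energy_log_neg_upper\<close>, \<open>kernel_log_neg_mass_finite\<close>).  Up to constants, the energy of \<open>w\<close>
  is therefore at most the integral of \<open>w powr p\<close> plus \<open>k powr p\<close> times the measure of \<open>A k\<close>.

  In the other direction the energy is coercive on small sets.  If \<open>A k\<close> fills at most half of a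
  ball of radius \<open>r \<le> 1 / e\<close>, then each point of \<open>A k\<close> sees many points within distance \<open>r\<close> at
  which \<open>w\<close> vanishes, and the energy of \<open>w\<close> is at least a multiple of
  \<open>r powr (- (s * p))\<close> times the integral of \<open>w powr p\<close> (\<open>energy_log_pos_lower\<close>).  This elementary
  bound takes the place of a fractional Sobolev inequality.

  Both estimates together feed a De Giorgi iteration (\<open>level_set_iteration\<close>), which shows that some
  level set is null, so that \<open>u\<close> is bounded above.  Since \<open>- u\<close> solves the same equation, \<open>u\<close> is
  bounded below as well.
\<close>

section \<open>Iteration over level sets\<close>

text \<open>
  De Giorgi's iteration.  Here \<open>a k\<close> stands for the measure of \<open>{u > k}\<close> and \<open>X k\<close> for
  the integral of \<open>(u - k)\<^sub>+ powr p\<close>.  The energy hypothesis is coercive at every scale \<open>r\<close>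
  whose ball has at least twice the measure of the level set; the smaller the level set, the
  smaller the admissible \<open>r\<close> and the larger the factor \<open>r powr (- (s * p))\<close>.  Once this factor
  beats \<open>L\<close>, the term \<open>L * X k\<close> is absorbed and
  \<open>X k \<le> (2 * L / c) * r powr (s * p) * k powr p * a k\<close>.

  Along the levels \<open>k\<^sub>n = K * (2 - 2\<^sup>-\<^sup>n)\<close> Chebyshev's inequality costs a factor of order \<open>2\<^sup>n\<^sup>p\<close>.
  The radii are prescribed to be \<open>r\<^sub>n = r\<^sub>0 * 2 powr (- n / s)\<close>, so that
  \<open>r\<^sub>n powr (s * p)\<close> cancels this factor exactly; a small \<open>r\<^sub>0\<close> then makes \<open>a k\<^sub>n\<close> decrease as fast as
  \<open>r\<^sub>n ^ N\<close>, and the scale \<open>r\<^sub>n\<^sub>+\<^sub>1\<close> is admissible again.  Hence \<open>a (2 * K) = 0\<close>.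
\<close>
lemma level_set_iteration:
  fixes a X :: "real \<Rightarrow> real" and N :: nat
  assumes p: "0 < p" and s: "0 < s" and c: "0 < c" and L: "0 \<le> L" and om: "0 < om"
    and R: "0 < R" and N: "0 < N"
    and a_nonneg: "\<And>k. 0 \<le> k \<Longrightarrow> 0 \<le> a k"
    and a_antimono: "\<And>k h. 0 \<le> k \<Longrightarrow> k \<le> h \<Longrightarrow> a h \<le> a k"
    and chebyshev: "\<And>k h. 0 \<le> k \<Longrightarrow> 0 < h \<Longrightarrow> h powr p * a (k + h) \<le> X k"
    and energy: "\<And>k r. 0 \<le> k \<Longrightarrow> 0 < r \<Longrightarrow> r \<le> R \<Longrightarrow> a k \<le> om / 2 * r ^ N \<Longrightarrow>
      c * r powr (- (s * p)) * X k \<le> L * (X k + k powr p * a k)"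
  shows "\<exists>k\<ge>0. a k = 0"
proof -
  define q where "q = 2 powr (- (real N / s))"
  (* q is the ratio of consecutive values of r_n ^ N; eps is chosen so that r powr (s * p) <= eps
     allows both the absorption (eps_L) and the decay of the level sets by the factor q (eps_q). *)
  define eps where "eps = c * q / ((2 * L + 1) * 4 powr p)"
  define r0 where "r0 = min R (eps powr (1 / (s * p)))"
  have q: "0 < q" "q < 1"
    using N s powr_less_mono[of "- (real N / s)" 0 2] by (auto simp: q_def)
  have four: "1 \<le> (4::real) powr p" using p by (simp add: ge_one_powr_ge_zero)
  have eps: "0 < eps" using c q L four by (simp add: eps_def)
  have r0: "0 < r0" "r0 \<le> R" using R eps by (auto simp: r0_def)
  have "r0 powr (s * p) \<le> (eps powr (1 / (s * p))) powr (s * p)"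
    using r0 p s by (intro powr_mono2) (auto simp: r0_def)
  then have r0_eps: "r0 powr (s * p) \<le> eps" using p s eps by (simp add: powr_powr)
  have "(2 * L + 1) * 4 powr p * eps = c * q" using L four by (simp add: eps_def)
  moreover have "2 * L * 4 powr p * eps \<le> (2 * L + 1) * 4 powr p * eps"
    using L four eps by (intro mult_right_mono) auto
  ultimately have eps_q: "2 * L * 4 powr p * eps \<le> c * q" by simp
  have "2 * L * eps * 1 \<le> 2 * L * eps * 4 powr p"
    using four L eps by (intro mult_left_mono) auto
  also have "\<dots> \<le> c * q" using eps_q by (simp add: mult_ac)
  also have "\<dots> \<le> c" using q c mult_left_le[of q c] by simp
  finally have eps_L: "2 * L * eps \<le> c" by simp
  have X_nonneg: "0 \<le> X k" if "0 \<le> k" for k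
    using chebyshev[OF that, of 1] a_nonneg[of "k+1"] that by simp
  have gain: "X k \<le> 2 * L / c * r powr (s * p) * k powr p * a k"
    if k: "0 \<le> k" and r: "0 < r" "r \<le> r0" and ak: "a k \<le> om / 2 * r ^ N" for k r
  proof -
    have "r powr (s * p) \<le> r0 powr (s * p)" using r p s by (intro powr_mono2) auto
    then have "2 * L * r powr (s * p) \<le> 2 * L * eps" using r0_eps L by (intro mult_left_mono) auto
    also have "\<dots> \<le> c" by (rule eps_L)
    finally have "L * r powr (s * p) * X k \<le> c / 2 * X k"
      using X_nonneg[OF k] by (intro mult_right_mono) auto
    moreover have "c * X k \<le> L * (X k + k powr p * a k) * r powr (s * p)"
    proof -
      have "c * X k = (c * r powr (- (s * p)) * X k) * r powr (s * p)"
        using r by (simp add: powr_minus field_simps)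
      also have "\<dots> \<le> L * (X k + k powr p * a k) * r powr (s * p)"
        using energy[OF k r(1) _ ak] r r0 by (intro mult_right_mono) auto
      finally show ?thesis .
    qed
    ultimately have "c * X k \<le> 2 * L * r powr (s * p) * k powr p * a k"
      by (simp add: algebra_simps)
    then show ?thesis using c by (simp add: field_simps)
  qed
  define Y where "Y = om / 2 * r0 ^ N"
  have Y: "0 < Y" using om r0 by (simp add: Y_def)
  (* A starting level at which Chebyshev's inequality from level 0 already gives a K <= Y. *)
  define K where "K = (X 0 / Y) powr (1 / p) + 1"
  have K: "0 < K" by (simp add: K_def add_nonneg_pos)
  have aK: "a K \<le> Y"
  proof (rule ccontr)
    assume "\<not> a K \<le> Y"
    have "X 0 / Y = ((X 0 / Y) powr (1 / p)) powr p"
      using X_nonneg[of 0] Y p by (simp add: powr_powr)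
    also have "\<dots> \<le> K powr p" using p by (intro powr_mono2) (auto simp: K_def)
    finally have "X 0 \<le> K powr p * Y" using Y by (simp add: field_simps)
    also have "\<dots> < K powr p * a K" using \<open>\<not> a K \<le> Y\<close> K by (intro mult_strict_left_mono) auto
    also have "\<dots> \<le> X 0" using chebyshev[of 0 K] K by simp
    finally show False by simp
  qed
  define k where "k n = K * (2 - (1/2) ^ n)" for n :: nat
  define r where "r n = r0 * 2 powr (- (real n / s))" for n :: nat
  have half: "0 < (1/2::real) ^ n" "(1/2::real) ^ n \<le> 1" for n
    by (auto simp: power_le_one)
  have k: "0 \<le> k n" "k n \<le> 2 * K" for n
    using K half[of n] by (auto simp: k_def)
  have r: "0 < r n" "r n \<le> r0" for n
    using r0 s powr_mono[of "- (real n / s)" 0 2] by (auto simp: r_def mult_left_le)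
  have r_pow: "r n ^ N = r0 ^ N * q ^ n" for n
  proof -
    have "(2 powr (- (real n / s))) ^ N = q ^ n"
      unfolding q_def by (simp add: powr_powr flip: powr_realpow) (simp add: mult.commute)
    then show ?thesis by (simp add: r_def power_mult_distrib)
  qed
  have a_k: "a (k n) \<le> Y * q ^ n" for n
  proof (induction n)
    case 0
    then show ?case using aK by (simp add: k_def)
  next
    case (Suc n)
    define h where "h = K * (1/2) ^ Suc n"
    have h: "0 < h" using K by (simp add: h_def)
    have "k n + h = k (Suc n)" by (simp add: k_def h_def algebra_simps)
    then have "h powr p * a (k (Suc n)) \<le> X (k n)" using chebyshev[OF k(1)[of n] h] by simp
    also have "\<dots> \<le> 2 * L / c * r n powr (s * p) * k n powr p * a (k n)"
      using Suc by (intro gain k r) (simp add: r_pow Y_def mult_ac)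
    also have "\<dots> \<le> 2 * L / c * r n powr (s * p) * (h * 4 * 2 ^ n) powr p * a (k n)"
    proof -
      have "k n \<le> h * 4 * 2 ^ n" using k(2)[of n] by (simp add: h_def power_one_over)
      then have "k n powr p \<le> (h * 4 * 2 ^ n) powr p" using k(1)[of n] p by (intro powr_mono2) auto
      then show ?thesis using L c a_nonneg[OF k(1)]
        by (intro mult_right_mono mult_left_mono) auto
    qed
    also have "\<dots> = h powr p * (2 * L * 4 powr p * r0 powr (s * p) / c * a (k n))"
    proof -
      have "r n powr (s * p) * (h * 4 * 2 ^ n) powr p
          = r0 powr (s * p) * h powr p * 4 powr p * ((2 powr (- (real n / s))) powr (s * p) * (2 ^ n) powr p)"
        using h r0 by (simp add: r_def powr_mult)
      \<comment> \<open>The decay of the radii pays for the loss in Chebyshev's inequality.\<close>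
      also have "(2 powr (- (real n / s))) powr (s * p) * (2 ^ n) powr p = (1::real)"
        using s by (simp add: powr_powr flip: powr_realpow powr_add)
      finally show ?thesis by (simp add: mult_ac)
    qed
    finally have "a (k (Suc n)) \<le> 2 * L * 4 powr p * r0 powr (s * p) / c * a (k n)"
      using h by (subst (asm) mult_le_cancel_left_pos) auto
    also have "\<dots> \<le> q * a (k n)"
    proof (intro mult_right_mono a_nonneg k)
      have "2 * L * 4 powr p * r0 powr (s * p) \<le> 2 * L * 4 powr p * eps"
        using r0_eps L by (intro mult_left_mono) auto
      then show "2 * L * 4 powr p * r0 powr (s * p) / c \<le> q"
        using eps_q c by (simp add: field_simps)
    qed
    also have "\<dots> \<le> q * (Y * q ^ n)" using Suc q by (intro mult_left_mono) auto
    finally show ?case by (simp add: mult_ac)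
  qed
  have "a (2 * K) \<le> Y * q ^ n" for n
    using a_antimono[OF k] a_k order_trans by blast
  moreover have "(\<lambda>n. Y * q ^ n) \<longlonglongrightarrow> Y * 0"
    using q by (intro tendsto_intros LIMSEQ_realpow_zero) auto
  ultimately have "a (2 * K) \<le> 0" using LIMSEQ_le_const by fastforce
  then show ?thesis using a_nonneg[of "2 * K"] K by (intro exI[of _ "2 * K"]) auto
qed

section \<open>The logarithmic kernels\<close>

text \<open>
  Comparison with a step function on the dyadic balls of radius \<open>2 ^ Suc n\<close>: the shell
  \<open>2 ^ n \<le> norm z < 2 ^ Suc n\<close> has volume of order \<open>2 powr (n * N)\<close> in dimension \<open>N\<close>, so it
  contributes a multiple of \<open>2 powr (- n * t)\<close>, which is summable.
\<close>
lemma nn_integral_norm_powr_tail: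
  assumes t: "0 < t"
  shows "(\<integral>\<^sup>+ (z::'a::euclidean_space).
      ennreal (norm z powr (- (real DIM('a) + t))) * indicator {z. 1 \<le> norm z} z \<partial>lborel) < \<infinity>"
proof -
  let ?N = "DIM('a)"
  define om where "om = measure lborel (ball (0::'a) 1)"
  define c where "c n = 2 powr (- (real n * (real ?N + t)))" for n :: nat
  define B where "B n = ball (0::'a) (2 ^ Suc n)" for n :: nat
  have pt: "ennreal (norm z powr (- (real ?N + t))) * indicator {z. 1 \<le> norm z} z
      \<le> (\<Sum>n. ennreal (c n) * indicator (B n) z)" for z :: 'a
  proof (cases "1 \<le> norm z")
    case True
    define n where "n = nat \<lfloor>log 2 (norm z)\<rfloor>"
    have pos: "0 < norm z" using True by linarith
    have "0 \<le> log 2 (norm z)" using True pos by (subst zero_le_log_cancel_iff) auto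
    then have n: "real n \<le> log 2 (norm z)" "log 2 (norm z) < real n + 1"
      unfolding n_def by linarith+
    have lo: "2 powr real n \<le> norm z" using n pos by (subst (asm) le_log_iff) auto
    have "norm z < 2 powr (real (Suc n))" using n pos by (subst (asm) log_less_iff) (auto simp: add.commute)
    then have "z \<in> B n" by (simp only: powr_realpow B_def) simp
    have "norm z powr (- (real ?N + t)) \<le> (2 powr real n) powr (- (real ?N + t))"
      using lo t by (intro powr_mono2') auto
    also have "\<dots> = c n" by (simp add: c_def powr_powr algebra_simps)
    finally have "ennreal (norm z powr (- (real ?N + t))) * indicator {z. 1 \<le> norm z} z
        \<le> ennreal (c n) * indicator (B n) z"
      using True \<open>z \<in> B n\<close> by (simp add: ennreal_leI)
    also have "\<dots> = (\<Sum>m\<in>{n}. ennreal (c m) * indicator (B m) z)"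
      by (subst sum.insert) auto
    also have "\<dots> \<le> (\<Sum>m. ennreal (c m) * indicator (B m) z)" by (rule sum_le_suminf) auto
    finally show ?thesis .
  qed auto
  have [measurable]: "B n \<in> sets borel" for n by (simp add: B_def)
  have ball: "emeasure lborel (B n) = ennreal ((2 ^ Suc n) ^ ?N * om)" for n
    using content_ball_conv_unit_ball[of "2 ^ Suc n" "0::'a"] emeasure_lborel_ball_finite[of "0::'a" "2 ^ Suc n"]
    by (simp add: B_def om_def emeasure_eq_ennreal_measure)
  have piece: "(\<integral>\<^sup>+ z. ennreal (c n) * indicator (B n) z \<partial>lborel)
      = ennreal (c n * ((2 ^ Suc n) ^ ?N * om))" for n
  proof -
    have "(\<integral>\<^sup>+ z. ennreal (c n) * indicator (B n) z \<partial>lborel) = ennreal (c n) * emeasure lborel (B n)"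
      by (rule nn_integral_cmult_indicator) simp
    also have "\<dots> = ennreal (c n * ((2 ^ Suc n) ^ ?N * om))"
      unfolding ball by (rule ennreal_mult'[symmetric]) (simp add: c_def)
    finally show ?thesis .
  qed
  have scaled: "c n * ((2 ^ Suc n) ^ ?N * om) = 2 ^ ?N * om * (2 powr (- t)) ^ n" for n
  proof -
    have "c n * (2 ^ n) ^ ?N = (2 powr (- t)) ^ n"
      by (simp add: c_def powr_powr flip: powr_realpow powr_add) (simp add: algebra_simps)
    then show ?thesis by (simp add: power_mult_distrib)
  qed
  have "(\<integral>\<^sup>+ (z::'a). ennreal (norm z powr (- (real ?N + t))) * indicator {z. 1 \<le> norm z} z \<partial>lborel)
      \<le> (\<integral>\<^sup>+ z. (\<Sum>n. ennreal (c n) * indicator (B n) z) \<partial>lborel)"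
    by (intro nn_integral_mono pt)
  also have "\<dots> = (\<Sum>n. \<integral>\<^sup>+ z. ennreal (c n) * indicator (B n) z \<partial>lborel)"
    by (intro nn_integral_suminf) measurable
  also have "\<dots> = (\<Sum>n. ennreal (c n * ((2 ^ Suc n) ^ ?N * om)))"
    by (simp only: piece)
  also have "\<dots> = (\<Sum>n. ennreal (2 ^ ?N * om * (2 powr (- t)) ^ n))"
    by (simp only: scaled)
  also have "\<dots> = ennreal (\<Sum>n. 2 ^ ?N * om * (2 powr (- t)) ^ n)"
  proof (rule suminf_ennreal2)
    show "summable (\<lambda>n. 2 ^ ?N * om * (2 powr (- t)) ^ n)"
      using t by (intro summable_mult summable_geometric) (simp add: powr_less_one)
  qed (simp add: om_def)
  also have "\<dots> < \<infinity>" by simp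
  finally show ?thesis .
qed

lemma C_const_pos:
  assumes "0 < s" "s < 1" "0 < p"
  shows "0 < C_const N s p"
proof -
  have "0 < Gamma (1 - s)" "0 < Gamma ((p + 1) / 2)" "0 < Gamma ((real N + s * p) / 2)"
    using assms by (auto intro!: Gamma_real_pos add_nonneg_pos)
  then show ?thesis using assms by (auto simp: C_const_def)
qed

text \<open>
  Outside the unit ball the logarithm costs less than any positive power of \<open>norm z\<close>; half of
  the decay exponent \<open>s * p\<close> is spent on it.
\<close>
lemma kernel_log_neg_mass_finite:
  assumes s: "0 < s" "s < 1" and p: "0 < p"
  shows "(\<integral>\<^sup>+ (z::'a::euclidean_space). ennreal (kernel_log_neg s p z) \<partial>lborel) < \<infinity>"
proof -
  define t where "t = s * p / 2"
  have t: "0 < t" using s p by (simp add: t_def)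
  let ?C = "C_const DIM('a) s p"
  let ?f = "\<lambda>z::'a. ennreal (norm z powr (- (real DIM('a) + t))) * indicator {z. 1 \<le> norm z} z"
  have C: "0 < ?C" using s p by (rule C_const_pos)
  have pt: "ennreal (kernel_log_neg s p z) \<le> ennreal (?C / t) * ?f z" for z :: 'a
  proof (cases "1 \<le> norm z")
    case True
    have "ln (norm z) \<le> norm z powr t / t" using True t by (rule ln_powr_bound)
    then have "ln (norm z) / norm z powr (real DIM('a) + s * p)
        \<le> (norm z powr t / t) / norm z powr (real DIM('a) + s * p)"
      by (intro divide_right_mono) auto
    also have "\<dots> = norm z powr (- (real DIM('a) + t)) / t"
    proof -
      have "norm z powr t / norm z powr (real DIM('a) + s * p) = norm z powr (t - (real DIM('a) + s * p))"
        by (simp only: powr_diff)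
      also have "t - (real DIM('a) + s * p) = - (real DIM('a) + t)" by (simp add: t_def)
      finally show ?thesis by (simp add: divide_divide_eq_left mult.commute flip: divide_divide_eq_left')
    qed
    finally have "ln (norm z) / norm z powr (real DIM('a) + s * p)
        \<le> norm z powr (- (real DIM('a) + t)) / t" .
    then have "kernel_log_neg s p z \<le> ?C / t * norm z powr (- (real DIM('a) + t))"
      using C True mult_left_mono[of _ _ ?C] by (fastforce simp: kernel_log_neg_def max_def)
    then have "ennreal (kernel_log_neg s p z) \<le> ennreal (?C / t * norm z powr (- (real DIM('a) + t)))"
      by (rule ennreal_leI)
    also have "\<dots> = ennreal (?C / t) * ?f z" using True C t by (subst ennreal_mult') auto
    finally show ?thesis .
  next
    case False
    then have "ln (norm z) \<le> 0" by (cases "z = 0") auto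
    then show ?thesis by (simp add: kernel_log_neg_def max_def)
  qed
  have "(\<integral>\<^sup>+ (z::'a). ennreal (kernel_log_neg s p z) \<partial>lborel) \<le> (\<integral>\<^sup>+ z. ennreal (?C / t) * ?f z \<partial>lborel)"
    by (intro nn_integral_mono pt)
  also have "\<dots> = ennreal (?C / t) * (\<integral>\<^sup>+ z. ?f z \<partial>lborel)"
    by (intro nn_integral_cmult) auto
  also have "\<dots> < \<infinity>"
    using nn_integral_norm_powr_tail[OF t, where 'a='a] by (simp add: ennreal_mult_less_top)
  finally show ?thesis .
qed

section \<open>Energies of truncations\<close>

text \<open>
  The algebra behind testing with \<open>(u - k)\<^sub>+\<close>, where \<open>a = u x\<close> and \<open>b = u y\<close>.  The truncation is
  monotone and contracts distances, which gives the first two bounds; the third keeps the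
  interaction between a point inside and a point outside the level set.
\<close>
lemma abs_powr_diff_truncate_bounds:
  fixes a b k p :: real
  assumes p: "1 < p"
  defines "d \<equiv> \<bar>a - b\<bar> powr (p - 2) * (a - b) * (max 0 (a - k) - max 0 (b - k))"
  shows "0 \<le> d" and "d \<le> \<bar>a - b\<bar> powr p"
    and "k < a \<Longrightarrow> b \<le> k \<Longrightarrow> (a - k) powr p \<le> d"
proof -
  let ?w = "max 0 (a - k) - max 0 (b - k)"
  have d: "d = \<bar>a - b\<bar> powr (p - 2) * ((a - b) * ?w)" by (simp add: d_def)
  have "0 \<le> (a - b) * ?w" by (cases "a \<le> b") (simp_all add: mult_nonpos_nonpos mult_nonneg_nonneg max_def)
  then show "0 \<le> d" unfolding d by (simp add: zero_le_mult_iff)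
  have square: "\<bar>t\<bar> powr (p - 2) * (\<bar>t\<bar> * \<bar>t\<bar>) = \<bar>t\<bar> powr p" for t :: real
    by (cases "t = 0") (auto simp: powr_mult_base powr_diff power2_eq_square)
  have "(a - b) * ?w \<le> \<bar>a - b\<bar> * \<bar>?w\<bar>" 
    using abs_ge_self[of "(a - b) * ?w"] by (simp only: abs_mult)
  also have "\<dots> \<le> \<bar>a - b\<bar> * \<bar>a - b\<bar>" by (intro mult_left_mono) auto
  finally have "d \<le> \<bar>a - b\<bar> powr (p - 2) * (\<bar>a - b\<bar> * \<bar>a - b\<bar>)"
    unfolding d by (intro mult_left_mono) auto
  then show "d \<le> \<bar>a - b\<bar> powr p" by (simp only: square)
  show "(a - k) powr p \<le> d" if "k < a" "b \<le> k"
  proof -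
    have "(a - k) powr p = (a - k) powr (p - 1) * (a - k)"
      using that by (simp add: powr_diff)
    also have "\<dots> \<le> (a - b) powr (p - 1) * (a - k)"
      using that p by (intro mult_right_mono powr_mono2) auto
    also have "(a - b) powr (p - 1) = (a - b) powr (p - 2) * (a - b)"
      using that powr_add[of "a - b" "p - 2" 1] by simp
    finally show ?thesis using that by (simp add: d_def)
  qed
qed

lemma kernel_log_pos_measurable [measurable]:
  "kernel_log_pos s p \<in> borel_measurable borel"
  unfolding kernel_log_pos_def[abs_def] by measurable

lemma kernel_log_neg_measurable [measurable]:
  "kernel_log_neg s p \<in> borel_measurable borel"
  unfolding kernel_log_neg_def[abs_def] by measurable

lemma kernel_s_measurable [measurable]:
  "kernel_s s p \<in> borel_measurable borel"
  unfolding kernel_s_def[abs_def] by measurable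

lemma energy_integrand_measurable:
  fixes u v k :: "'a::euclidean_space \<Rightarrow> real"
  assumes [measurable]: "u \<in> borel_measurable borel" "v \<in> borel_measurable borel"
    "k \<in> borel_measurable borel"
  shows "(\<lambda>(x, y). \<bar>u x - u y\<bar> powr (p - 2) * (u x - u y) * (v x - v y) * k (x - y))
    \<in> borel_measurable lborel"
  unfolding lborel_prod[symmetric] by measurable

lemma energy_lborel:
  fixes u v k :: "'a::euclidean_space \<Rightarrow> real"
  assumes "u \<in> borel_measurable borel" "v \<in> borel_measurable borel"
    "k \<in> borel_measurable borel"
  shows "energy p k u v =
    (\<integral>(x, y). \<bar>u x - u y\<bar> powr (p - 2) * (u x - u y) * (v x - v y) * k (x - y) \<partial>lborel)"
  unfolding energy_def using energy_integrand_measurable[OF assms]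
  by (intro integral_completion) simp

lemma nn_integral_lborel_reflect_translate:
  fixes f :: "'a::euclidean_space \<Rightarrow> ennreal"
  assumes [measurable]: "f \<in> borel_measurable borel"
  shows "(\<integral>\<^sup>+ y. f (x - y) \<partial>lborel) = (\<integral>\<^sup>+ y. f y \<partial>lborel)"
proof -
  have "lborel = density (distr lborel borel (\<lambda>y. x + (-1) *\<^sub>R y)) (\<lambda>_. ennreal (\<bar>-1\<bar> ^ DIM('a)))"
    by (rule lborel_affine) simp
  then have "distr lborel borel (\<lambda>y. x - y) = lborel" by (simp add: density_1)
  then have "(\<integral>\<^sup>+ y. f y \<partial>lborel) = (\<integral>\<^sup>+ y. f y \<partial>distr lborel borel (\<lambda>y. x - y))" by simp
  also have "\<dots> = (\<integral>\<^sup>+ y. f (x - y) \<partial>lborel)" by (rule nn_integral_distr) auto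
  finally show ?thesis by simp
qed

text \<open>
  This holds also when the integrand is not integrable, as the Bochner integral is then \<open>0\<close>.
\<close>
lemma energy_truncation_nonneg:
  fixes u k :: "'a::euclidean_space \<Rightarrow> real"
  assumes p: "1 < p" and k: "\<And>z. 0 \<le> k z"
  shows "0 \<le> energy p k u (\<lambda>x. max 0 (u x - l))"
  unfolding energy_def
  by (intro integral_nonneg_AE)
    (auto simp: case_prod_unfold intro!: mult_nonneg_nonneg k abs_powr_diff_truncate_bounds(1)[OF p])

text \<open>
  A Poincare inequality on small level sets.  A point \<open>x\<close> of the level set \<open>A = {u > k}\<close> interacts
  with all points of \<open>ball x r - A\<close>, whose measure is at least that of the ball minus that of
  \<open>A\<close>.  By the third bound of \<open>abs_powr_diff_truncate_bounds\<close> each such pair contributes at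
  least \<open>(u x - k) powr p\<close> times the kernel, and for \<open>r \<le> 1 / e\<close> the logarithm is at least \<open>1\<close>.
  The finiteness assumption makes the energy an honest integral, so that it can be bounded from
  below.
\<close>
lemma energy_log_pos_lower:
  fixes u :: "'a::euclidean_space \<Rightarrow> real"
  assumes p: "1 < p" and s: "0 < s" "s < 1"
    and u [measurable]: "u \<in> borel_measurable borel"
    and fin: "(\<integral>\<^sup>+ (x, y). ennreal (\<bar>u x - u y\<bar> powr p * kernel_log_pos s p (x - y))
       \<partial>(lborel :: ('a \<times> 'a) measure)) < \<infinity>"
    and r: "0 < r" "r \<le> exp (- 1)"
    and A: "emeasure lborel {x. k < u x} < \<infinity>"
    and X: "integrable lborel (\<lambda>x. max 0 (u x - k) powr p)"
  shows "C_const DIM('a) s p * r powr (- (real DIM('a) + s * p))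
      * (measure lborel (ball (0::'a) r) - measure lborel {x. k < u x})
      * (\<integral>x. max 0 (u x - k) powr p \<partial>lborel)
    \<le> energy p (kernel_log_pos s p) u (\<lambda>x. max 0 (u x - k))"
    (is "?c * (?b - ?a) * ?X \<le> ?E")
proof -
  let ?w = "\<lambda>x. max 0 (u x - k)"
  let ?K = "kernel_log_pos s p :: 'a \<Rightarrow> real"
  let ?A = "{x. k < u x}"
  define F where "F = (\<lambda>(x, y). \<bar>u x - u y\<bar> powr (p - 2) * (u x - u y) * (?w x - ?w y) * ?K (x - y))"
  have C: "0 < C_const DIM('a) s p" using s p by (intro C_const_pos) auto
  have K: "0 \<le> ?K z" for z using C by (simp add: kernel_log_pos_def)
  have w [measurable]: "?w \<in> borel_measurable borel" by measurable
  have F_meas: "F \<in> borel_measurable lborel"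
    unfolding F_def by (rule energy_integrand_measurable[OF u w]) measurable
  have E: "?E = (\<integral>z. F z \<partial>lborel)"
    unfolding F_def by (rule energy_lborel[OF u w]) measurable
  have F_nonneg: "0 \<le> F z" for z
    unfolding F_def case_prod_unfold
    by (intro mult_nonneg_nonneg K abs_powr_diff_truncate_bounds(1)[OF p])
  have F_le: "F z \<le> (case z of (x, y) \<Rightarrow> \<bar>u x - u y\<bar> powr p * ?K (x - y))" for z
    unfolding F_def case_prod_unfold
    by (intro mult_right_mono K abs_powr_diff_truncate_bounds(2)[OF p])
  have "(\<integral>\<^sup>+ z. ennreal (F z) \<partial>lborel)
      \<le> (\<integral>\<^sup>+ (x, y). ennreal (\<bar>u x - u y\<bar> powr p * ?K (x - y)) \<partial>lborel)"
    using F_le by (intro nn_integral_mono) (auto simp: case_prod_unfold intro!: ennreal_leI)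
  then have F_fin: "(\<integral>\<^sup>+ z. ennreal (F z) \<partial>lborel) < \<infinity>" using fin by (rule le_less_trans)
  have F_int: "integrable lborel F"
    using F_meas F_nonneg F_fin by (intro integrableI_nonneg) auto
  have E_nn: "ennreal ?E = (\<integral>\<^sup>+ z. ennreal (F z) \<partial>lborel)"
    unfolding E using F_int F_nonneg by (intro nn_integral_eq_integral[symmetric]) auto
  have E0: "0 \<le> ?E" unfolding E using F_nonneg by (intro integral_nonneg_AE) auto
  have A_sets [measurable]: "?A \<in> sets borel" by measurable
  have c: "0 < ?c" using C r by simp
  (* The part of the energy coming from x in A and y in ball x r - A; in particular x and y
     differ there, so the kernel is evaluated away from 0. *)
  define h where "h = (\<lambda>(x, y). ennreal (?c * ?w x powr p) * indicator (ball x r - ?A) y)"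
  have h_F: "h z \<le> ennreal (F z)" for z
  proof (cases z)
    case (Pair x y)
    show ?thesis
    proof (cases "k < u x \<and> y \<in> ball x r - ?A")
      case True
      then have xy: "k < u x" "u y \<le> k" "dist x y < r" by auto
      then have "x \<noteq> y" by auto
      then have n: "0 < norm (x - y)" "norm (x - y) < r" using xy by (auto simp: dist_norm)
      have "ln (norm (x - y)) \<le> ln (exp (- 1))" using n r by (subst ln_le_cancel_iff) auto
      then have ln: "1 \<le> max 0 (- ln (norm (x - y)))" by simp
      have "?c = C_const DIM('a) s p * 1 / r powr (real DIM('a) + s * p)"
        unfolding powr_minus_divide by simp
      also have "\<dots> \<le> ?K (x - y)"
        unfolding kernel_log_pos_def using C ln n r s p
        by (intro frac_le mult_left_mono powr_mono2) auto
      finally have "?w x powr p * ?c \<le> (\<bar>u x - u y\<bar> powr (p - 2) * (u x - u y) * (?w x - ?w y)) * ?K (x - y)"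
        using abs_powr_diff_truncate_bounds(1)[OF p, of "u x" "u y" k]
          abs_powr_diff_truncate_bounds(3)[OF p xy(1,2)] xy c
        by (intro mult_mono) (auto simp: max_def)
      then show ?thesis using Pair True by (simp add: h_def F_def mult.commute ennreal_leI)
    next
      case False
      then show ?thesis using p by (auto simp: h_def Pair max_def split: split_indicator)
    qed
  qed
  have h_meas: "h \<in> borel_measurable (lborel \<Otimes>\<^sub>M lborel)"
  proof -
    have "h = (\<lambda>(x, y). ennreal (?c * ?w x powr p) * indicator {z. dist (fst z) (snd z) < r \<and> u (snd z) \<le> k} (x, y))"
      by (auto simp: h_def fun_eq_iff split: split_indicator)
    also have "\<dots> \<in> borel_measurable (lborel \<Otimes>\<^sub>M lborel)" by measurable
    finally show ?thesis .
  qed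
  have slice: "ennreal (?b - ?a) \<le> emeasure lborel (ball x r - ?A)" for x
  proof -
    have fb: "emeasure lborel (ball x r) < \<infinity>" by (rule emeasure_lborel_ball_finite)
    have "emeasure lborel (ball x r - ?A) \<le> emeasure lborel (ball x r)"
      by (rule emeasure_mono) auto
    then have fd: "emeasure lborel (ball x r - ?A) < \<infinity>" using fb by (rule le_less_trans)
    have "?b = measure lborel (ball x r)"
      using content_ball_conv_unit_ball[of r x] content_ball_conv_unit_ball[of r "0::'a"] r by simp
    also have "\<dots> \<le> measure lborel ((ball x r - ?A) \<union> ?A)"
    proof (rule measure_mono_fmeasurable)
      have "emeasure lborel ((ball x r - ?A) \<union> ?A) \<le> emeasure lborel (ball x r - ?A) + emeasure lborel ?A"
        by (rule emeasure_subadditive) auto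
      also have "\<dots> < \<infinity>" using fd A by simp
      finally show "(ball x r - ?A) \<union> ?A \<in> fmeasurable lborel" by (intro fmeasurableI) auto
    qed auto
    also have "\<dots> \<le> measure lborel (ball x r - ?A) + ?a"
      by (intro measure_Un_le) auto
    finally have "ennreal (?b - ?a) \<le> ennreal (measure lborel (ball x r - ?A))" by (intro ennreal_leI) simp
    also have "\<dots> = emeasure lborel (ball x r - ?A)"
      using fd by (intro emeasure_eq_ennreal_measure[symmetric]) auto
    finally show ?thesis .
  qed
  show ?thesis
  proof (cases "?a \<le> ?b")
    case False
    have "0 \<le> ?X" by (intro integral_nonneg_AE) auto
    then have "?c * (?b - ?a) * ?X \<le> 0" using False c by (intro mult_nonpos_nonneg mult_nonneg_nonpos) auto
    then show ?thesis using E0 by linarith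
  next
    case True
    have "ennreal (?c * (?b - ?a) * ?X) = ennreal (?b - ?a) * (ennreal ?c * ennreal ?X)"
    proof -
      have "ennreal (x * y * z) = ennreal y * (ennreal x * ennreal z)" if "0 \<le> x" "0 \<le> y" for x y z
        using that by (simp add: ennreal_mult' mult_ac)
      from this[of ?c "?b - ?a" ?X] show ?thesis using c True by simp
    qed
    also have "ennreal ?X = (\<integral>\<^sup>+ x. ennreal (?w x powr p) \<partial>lborel)"
      using X by (intro nn_integral_eq_integral[symmetric]) auto
    also have "ennreal (?b - ?a) * (ennreal ?c * \<dots>) = (\<integral>\<^sup>+ x. ennreal (?c * ?w x powr p) * ennreal (?b - ?a) \<partial>lborel)"
      using c by (simp add: nn_integral_cmult nn_integral_multc ennreal_mult' mult.commute)
    also have "\<dots> \<le> (\<integral>\<^sup>+ x. ennreal (?c * ?w x powr p) * emeasure lborel (ball x r - ?A) \<partial>lborel)"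
      by (intro nn_integral_mono mult_left_mono slice) auto
    also have "\<dots> = (\<integral>\<^sup>+ x. \<integral>\<^sup>+ y. h (x, y) \<partial>lborel \<partial>lborel)"
      unfolding h_def prod.case
      by (intro nn_integral_cong nn_integral_cmult_indicator[symmetric]) auto
    also have "\<dots> = (\<integral>\<^sup>+ z. h z \<partial>(lborel \<Otimes>\<^sub>M lborel))"
      by (rule lborel.nn_integral_fst[OF h_meas])
    also have "\<dots> \<le> ennreal ?E" unfolding E_nn lborel_prod by (intro nn_integral_mono h_F)
    finally show ?thesis using E0 by (simp add: ennreal_le_iff)
  qed
qed

text \<open>
  The negative part of the logarithmic kernel lives on \<open>dist x y > 1\<close>, where one of \<open>u x\<close> and
  \<open>u y\<close> vanishes.  There the integrand splits into a function of one point times the kernel, and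
  integrating out the other point produces the finite mass of the kernel.
\<close>
lemma energy_log_neg_upper:
  fixes u :: "'a::euclidean_space \<Rightarrow> real"
  assumes p: "1 < p" and s: "0 < s" "s < 1" and k: "0 \<le> k"
    and u [measurable]: "u \<in> borel_measurable borel"
    and sep: "\<And>x y. 1 < dist x y \<Longrightarrow> u x = 0 \<or> u y = 0"
    and T: "integrable lborel (\<lambda>x. \<bar>u x\<bar> powr (p - 2) * u x * max 0 (u x - k))"
  shows "energy p (kernel_log_neg s p) u (\<lambda>x. max 0 (u x - k))
    \<le> 2 * (\<integral>z. kernel_log_neg s p (z :: 'a) \<partial>lborel)
        * (\<integral>x. \<bar>u x\<bar> powr (p - 2) * u x * max 0 (u x - k) \<partial>lborel)"
proof -
  let ?w = "\<lambda>x. max 0 (u x - k)"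
  let ?K = "kernel_log_neg s p :: 'a \<Rightarrow> real"
  define tau where "tau x = \<bar>u x\<bar> powr (p - 2) * u x * ?w x" for x
  have tau_meas [measurable]: "tau \<in> borel_measurable borel" unfolding tau_def[abs_def] by measurable
  have tau_int: "integrable lborel tau" using T by (simp add: tau_def[abs_def])
  have tau0: "0 \<le> tau x" for x
    using k by (auto simp: tau_def max_def)
  have C: "0 < C_const DIM('a) s p" using s p by (intro C_const_pos) auto
  have K0: "0 \<le> ?K z" for z using C by (simp add: kernel_log_neg_def)
  have K_even: "?K (x - y) = ?K (y - x)" for x y
    by (simp add: kernel_log_neg_def norm_minus_commute)
  have K_int: "integrable lborel ?K"
    using kernel_log_neg_mass_finite[OF s, of p, where 'a='a] p K0 by (intro integrableI_nonneg) auto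
  define M where "M = (\<integral>z. ?K z \<partial>lborel)"
  have M: "(\<integral>\<^sup>+ z. ennreal (?K z) \<partial>lborel) = ennreal M" "0 \<le> M"
    unfolding M_def using K_int K0 by (auto intro!: nn_integral_eq_integral integral_nonneg_AE)
  define T' where "T' = (\<integral>x. tau x \<partial>lborel)"
  have T': "(\<integral>\<^sup>+ x. ennreal (tau x) \<partial>lborel) = ennreal T'" "0 \<le> T'"
    unfolding T'_def using tau_int tau0 by (auto intro!: nn_integral_eq_integral integral_nonneg_AE)
  define F where "F = (\<lambda>(x, y). \<bar>u x - u y\<bar> powr (p - 2) * (u x - u y) * (?w x - ?w y) * ?K (x - y))"
  have w [measurable]: "?w \<in> borel_measurable borel" by measurable
  have F_meas: "F \<in> borel_measurable lborel"
    unfolding F_def by (rule energy_integrand_measurable[OF u w]) measurable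
  have F_nonneg: "0 \<le> F z" for z
    unfolding F_def case_prod_unfold
    by (intro mult_nonneg_nonneg K0 abs_powr_diff_truncate_bounds(1)[OF p])
  have F_le: "F (x, y) \<le> tau x * ?K (x - y) + tau y * ?K (x - y)" for x y
  proof (cases "1 < dist x y")
    case True
    then consider "u x = 0" | "u y = 0" using sep by blast
    then show ?thesis
    proof cases
      case 1
      then have "F (x, y) = tau y * ?K (x - y)" using k by (simp add: F_def tau_def)
      then show ?thesis using mult_nonneg_nonneg[OF tau0[of x] K0[of "x - y"]] by simp
    next
      case 2
      then have "F (x, y) = tau x * ?K (x - y)" using k by (simp add: F_def tau_def)
      then show ?thesis using mult_nonneg_nonneg[OF tau0[of y] K0[of "x - y"]] by simp
    qed
  next
    case False
    then have "ln (norm (x - y)) \<le> 0" by (cases "x = y") (auto simp: dist_norm)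
    then have "?K (x - y) = 0" by (simp add: kernel_log_neg_def max_def)
    then show ?thesis by (simp add: F_def)
  qed
  have K_slice: "(\<integral>\<^sup>+ y. ennreal (?K (x - y)) \<partial>lborel) = ennreal M" for x
    using nn_integral_lborel_reflect_translate[of "\<lambda>z. ennreal (?K z)" x] M by simp
  have half: "(\<integral>\<^sup>+ x. \<integral>\<^sup>+ y. ennreal (tau x * ?K (x - y)) \<partial>lborel \<partial>lborel) = ennreal (M * T')"
  proof -
    have "(\<integral>\<^sup>+ x. \<integral>\<^sup>+ y. ennreal (tau x * ?K (x - y)) \<partial>lborel \<partial>lborel)
        = (\<integral>\<^sup>+ x. ennreal (tau x) * ennreal M \<partial>lborel)"
      by (intro nn_integral_cong) (simp add: ennreal_mult' tau0 nn_integral_cmult K_slice)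
    also have "\<dots> = ennreal (M * T')" 
      using M(2) by (subst nn_integral_multc) (auto simp: T' ennreal_mult' mult.commute)
    finally show ?thesis .
  qed
  have m1: "(\<lambda>(x, y). ennreal (tau x * ?K (x - y))) \<in> borel_measurable (lborel \<Otimes>\<^sub>M lborel)"
    by measurable
  have m2: "(\<lambda>(x, y). ennreal (tau y * ?K (x - y))) \<in> borel_measurable (lborel \<Otimes>\<^sub>M lborel)"
    by measurable
  have "(\<integral>\<^sup>+ z. ennreal (F z) \<partial>lborel)
      \<le> (\<integral>\<^sup>+ z. (case z of (x, y) \<Rightarrow> ennreal (tau x * ?K (x - y)))
          + (case z of (x, y) \<Rightarrow> ennreal (tau y * ?K (x - y))) \<partial>lborel)"
  proof (intro nn_integral_mono)
    fix z :: "'a \<times> 'a"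
    show "ennreal (F z) \<le> (case z of (x, y) \<Rightarrow> ennreal (tau x * ?K (x - y)))
          + (case z of (x, y) \<Rightarrow> ennreal (tau y * ?K (x - y)))"
      using F_le[of "fst z" "snd z"] tau0 K0
      by (auto simp: case_prod_unfold simp flip: ennreal_plus intro!: ennreal_leI)
  qed
  also have "\<dots> = (\<integral>\<^sup>+ (x, y). ennreal (tau x * ?K (x - y)) \<partial>(lborel \<Otimes>\<^sub>M lborel))
      + (\<integral>\<^sup>+ (x, y). ennreal (tau y * ?K (x - y)) \<partial>(lborel \<Otimes>\<^sub>M lborel))"
    unfolding lborel_prod[symmetric] using m1 m2 by (rule nn_integral_add)
  also have "(\<integral>\<^sup>+ (x, y). ennreal (tau x * ?K (x - y)) \<partial>(lborel \<Otimes>\<^sub>M lborel)) = ennreal (M * T')"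
    using lborel.nn_integral_fst[OF m1] half by simp
  also have "(\<integral>\<^sup>+ (x, y). ennreal (tau y * ?K (x - y)) \<partial>(lborel \<Otimes>\<^sub>M lborel)) = ennreal (M * T')"
    using lborel_pair.nn_integral_snd[OF m2] half by (simp add: K_even)
  also have "ennreal (M * T') + ennreal (M * T') = ennreal (2 * M * T')"
    using M T' by (simp flip: ennreal_plus)
  finally have le: "(\<integral>\<^sup>+ z. ennreal (F z) \<partial>lborel) \<le> ennreal (2 * M * T')" .
  have "energy p ?K u ?w = (\<integral>z. F z \<partial>lborel)"
    unfolding F_def by (rule energy_lborel[OF u w]) measurable
  also have "\<dots> = enn2real (\<integral>\<^sup>+ z. ennreal (F z) \<partial>lborel)"
    using F_meas F_nonneg by (intro integral_eq_nn_integral) auto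
  also have "\<dots> \<le> 2 * M * T'"
    using le M T' by (intro enn2real_leI) auto
  finally show ?thesis by (simp add: M_def T'_def tau_def)
qed

section \<open>One-sided bounds for weak solutions\<close>

text \<open>
  For \<open>w = (u - k)\<^sub>+\<close> write \<open>T k\<close> for the integral of \<open>|u| powr (p - 2) * u * w\<close>.  The equation
  tested with \<open>w\<close>, the sign of the pure \<open>s\<close>-energy (this is where \<open>B \<ge> 0\<close> enters) and
  \<open>energy_log_neg_upper\<close> bound \<open>p / 2\<close> times the positive logarithmic energy by
  \<open>(|lam| + p * M) * T k\<close>, with \<open>M\<close> the mass of the negative kernel.  Since \<open>u = w + k\<close> on
  the level set, \<open>T k\<close> is at most \<open>2 powr p\<close> times the integral of \<open>w powr p\<close> plus
  \<open>k powr p\<close> times the measure of the level set.  Together with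
  \<open>energy_log_pos_lower\<close> this is the energy hypothesis of \<open>level_set_iteration\<close>.
\<close>
lemma borel_solution_bounded_above:
  fixes u :: "'a::euclidean_space \<Rightarrow> real"
  assumes p: "1 < p" and s: "0 < s" "s < 1" and B: "0 \<le> B_const DIM('a) s p"
    and Om: "bounded \<Omega>" "diameter \<Omega> \<le> 1"
    and u [measurable]: "u \<in> borel_measurable borel"
    and supp: "\<And>x. x \<notin> \<Omega> \<Longrightarrow> u x = 0"
    and Lp: "integrable lborel (\<lambda>x. \<bar>u x\<bar> powr p)"
    and fin: "(\<integral>\<^sup>+ (x, y). ennreal (\<bar>u x - u y\<bar> powr p * kernel_log_pos s p (x - y))
       \<partial>(lborel :: ('a \<times> 'a) measure)) < \<infinity>"
    and eq: "\<And>k. 0 \<le> k \<Longrightarrow> J_slog s p u (\<lambda>x. max 0 (u x - k))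
      = lam * (\<integral>x. \<bar>u x\<bar> powr (p - 2) * u x * max 0 (u x - k) \<partial>lborel)"
  shows "\<exists>k\<ge>0. AE x in lborel. u x \<le> k"
proof -
  define N where "N = DIM('a)"
  define C where "C = C_const N s p"
  define om where "om = measure lborel (ball (0::'a) 1)"
  define M where "M = (\<integral>z. kernel_log_neg s p (z :: 'a) \<partial>lborel)"
  define A where "A k = {x. k < u x}" for k
  define a where "a k = measure lborel (A k)" for k
  define X where "X k = (\<integral>x. max 0 (u x - k) powr p \<partial>lborel)" for k
  define tau where "tau k x = \<bar>u x\<bar> powr (p - 2) * u x * max 0 (u x - k)" for k x
  define T where "T k = (\<integral>x. tau k x \<partial>lborel)" for k
  have C: "0 < C" unfolding C_def using s p by (intro C_const_pos) auto
  have om: "0 < om" by (simp add: om_def content_ball_pos)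
  have M: "0 \<le> M" using C unfolding M_def
    by (intro integral_nonneg_AE) (auto simp: kernel_log_neg_def C_def N_def)
  have A_meas [measurable]: "A k \<in> sets borel" for k unfolding A_def by measurable
  have A_fin: "emeasure lborel (A k) < \<infinity>" if "0 \<le> k" for k
  proof -
    have "A k \<subseteq> \<Omega>" using supp that by (fastforce simp: A_def)
    then show ?thesis using Om(1) bounded_subset emeasure_bounded_finite by blast
  qed
  have X_int: "integrable lborel (\<lambda>x. max 0 (u x - k) powr p)" if "0 \<le> k" for k
    using that p by (intro Bochner_Integration.integrable_bound[OF Lp]) (auto intro!: powr_mono2)
  have tau_nonneg: "0 \<le> tau k x" if "0 \<le> k" for k x
    using that by (auto simp: tau_def max_def)
  have tau_le: "tau k x \<le> \<bar>u x\<bar> powr p" if "0 \<le> k" for k x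
  proof (cases "k < u x")
    case True
    then have "tau k x \<le> \<bar>u x\<bar> powr (p - 2) * u x * u x"
      unfolding tau_def using that by (intro mult_left_mono) auto
    also have "\<dots> = \<bar>u x\<bar> powr p"
      using True that by (simp add: powr_diff power2_eq_square)
    finally show ?thesis .
  qed (simp add: tau_def)
  have T_int: "integrable lborel (tau k)" if "0 \<le> k" for k
    using that tau_nonneg tau_le
    by (intro Bochner_Integration.integrable_bound[OF Lp]) (auto simp: tau_def[abs_def])
  have T_nonneg: "0 \<le> T k" if "0 \<le> k" for k
    unfolding T_def using tau_nonneg[OF that] by (intro integral_nonneg_AE) auto
  have sep: "u x = 0 \<or> u y = 0" if "1 < dist x y" for x y
    using diameter_bounded_bound[OF Om(1), of x y] Om(2) supp that by force
  have T_le: "T k \<le> 2 powr p * (X k + k powr p * a k)" if k: "0 \<le> k" for k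
  proof -
    have pt: "tau k x \<le> 2 powr p * (max 0 (u x - k) powr p + k powr p * indicator (A k) x)" for x
    proof (cases "k < u x")
      case True
      let ?m = "max (u x - k) k"
      have "\<bar>u x\<bar> powr p \<le> (2 * ?m) powr p" using True k p by (intro powr_mono2) (auto simp: max_def)
      also have "\<dots> = 2 powr p * ?m powr p" using k by (simp add: powr_mult)
      also have "?m powr p \<le> (u x - k) powr p + k powr p" by (simp add: max_def)
      finally show ?thesis using tau_le[OF k, of x] True by (simp add: A_def max_def)
    qed (simp add: tau_def)
    have "integrable lborel (indicator (A k) :: 'a \<Rightarrow> real)"
      using A_fin[OF k] by (intro integrable_real_indicator) auto
    then have "T k \<le> (\<integral>x. 2 powr p * (max 0 (u x - k) powr p + k powr p * indicator (A k) x) \<partial>lborel)"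
      unfolding T_def using X_int[OF k] T_int[OF k] pt by (intro integral_mono) auto
    also have "\<dots> = 2 powr p * (X k + k powr p * a k)"
      using X_int[OF k] A_fin[OF k] \<open>integrable lborel (indicator (A k))\<close> by (simp add: X_def a_def)
    finally show ?thesis .
  qed
  have chebyshev: "h powr p * a (k + h) \<le> X k" if "0 \<le> k" "0 < h" for k h
  proof -
    have int: "integrable lborel (indicator (A (k + h)) :: 'a \<Rightarrow> real)"
      using A_fin[of "k + h"] that by (intro integrable_real_indicator) auto
    have "h powr p * a (k + h) = (\<integral>x. h powr p * indicator (A (k + h)) x \<partial>lborel)"
      using int by (simp add: a_def)
    also have "\<dots> \<le> X k"
      unfolding X_def using int X_int[OF that(1)] that p
      by (intro integral_mono) (auto simp: A_def intro!: powr_mono2 split: split_indicator)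
    finally show ?thesis .
  qed
  have mono: "a h \<le> a k" if "0 \<le> k" "k \<le> h" for k h
  proof -
    have "A k \<in> fmeasurable lborel" using A_fin[OF that(1)] by (auto simp: fmeasurable_def)
    then show ?thesis unfolding a_def using that by (intro measure_mono_fmeasurable) (auto simp: A_def)
  qed
  have step: "p / 2 * C * (om / 2) * r powr (- (s * p)) * X k
      \<le> (\<bar>lam\<bar> + p * M) * 2 powr p * (X k + k powr p * a k)"
    if k: "0 \<le> k" and r: "0 < r" "r \<le> exp (- 1)" and ak: "a k \<le> om / 2 * r ^ N" for k r
  proof -
    let ?w = "\<lambda>x. max 0 (u x - k)"
    let ?P = "energy p (kernel_log_pos s p) u ?w"
    have X0: "0 \<le> X k" unfolding X_def by (intro integral_nonneg_AE) auto
    have "C * r powr (- (real N + s * p)) * (measure lborel (ball (0::'a) r) - a k) * X k \<le> ?P"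
      unfolding C_def N_def a_def A_def X_def using A_fin[OF k] X_int[OF k]
      by (intro energy_log_pos_lower p s u fin r) (auto simp: A_def)
    moreover have "C * (om / 2) * r powr (- (s * p)) * X k
        \<le> C * r powr (- (real N + s * p)) * (measure lborel (ball (0::'a) r) - a k) * X k"
    proof -
      have "om / 2 * r ^ N \<le> measure lborel (ball (0::'a) r) - a k"
        using content_ball_conv_unit_ball[of r "0::'a"] r ak by (simp add: om_def N_def mult.commute)
      then have "C * r powr (- (real N + s * p)) * (om / 2 * r ^ N) * X k
        \<le> C * r powr (- (real N + s * p)) * (measure lborel (ball (0::'a) r) - a k) * X k"
        using C X0 by (intro mult_right_mono mult_left_mono) auto
      moreover have "r powr (- (real N + s * p)) * r ^ N = r powr (- (s * p))"
        using r by (simp flip: powr_realpow powr_add)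
      ultimately show ?thesis by (simp add: mult_ac)
    qed
    ultimately have "C * (om / 2) * r powr (- (s * p)) * X k \<le> ?P" by linarith
    then have "p / 2 * (C * (om / 2) * r powr (- (s * p)) * X k) \<le> p / 2 * ?P"
      using p by (intro mult_left_mono) auto
    also have "\<dots> \<le> lam * T k + p / 2 * energy p (kernel_log_neg s p) u ?w"
    proof -
      have "0 \<le> energy p (kernel_s s p) u ?w"
        by (rule energy_truncation_nonneg[OF p]) (simp add: kernel_s_def)
      then have "0 \<le> B_const N s p * C / 2 * energy p (kernel_s s p) u ?w"
        using B C by (simp add: N_def)
      then show ?thesis using eq[OF k]
        by (simp add: J_slog_def T_def tau_def C_def N_def algebra_simps)
    qed
    also have "p / 2 * energy p (kernel_log_neg s p) u ?w \<le> p / 2 * (2 * M * T k)"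
      unfolding M_def T_def tau_def using p T_int[OF k]
      by (intro mult_left_mono energy_log_neg_upper p s k u sep) (auto simp: tau_def[abs_def])
    also have "lam * T k \<le> \<bar>lam\<bar> * T k" using T_nonneg[OF k] by (intro mult_right_mono) auto
    also have "\<bar>lam\<bar> * T k + p / 2 * (2 * M * T k) = (\<bar>lam\<bar> + p * M) * T k"
      by (simp add: algebra_simps)
    also have "\<dots> \<le> (\<bar>lam\<bar> + p * M) * (2 powr p * (X k + k powr p * a k))"
      using T_le[OF k] M p by (intro mult_left_mono) auto
    finally show ?thesis by (simp add: mult_ac)
  qed
  have "\<exists>k\<ge>0. a k = 0"
  proof (rule level_set_iteration[where p = p and s = s and X = X and N = N and R = "exp (- 1)"
        and om = om and c = "p / 2 * C * (om / 2)" and L = "(\<bar>lam\<bar> + p * M) * 2 powr p"])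
    show "0 < p / 2 * C * (om / 2)" using p C om by simp
    show "0 \<le> (\<bar>lam\<bar> + p * M) * 2 powr p" using p M by simp
  qed (use p s om step chebyshev mono in \<open>auto simp: N_def a_def\<close>)
  then obtain k where k: "0 \<le> k" "a k = 0" by auto
  then have "emeasure lborel (A k) = 0"
    using A_fin[OF k(1)] by (subst emeasure_eq_ennreal_measure) (auto simp: a_def)
  then have "AE x in lborel. x \<notin> A k" by (intro AE_not_in) (auto simp: null_sets_def)
  then show ?thesis using k by (auto simp: A_def not_less)
qed

section \<open>From Lebesgue to Borel measurable solutions\<close>

text \<open>
  Fubini's theorem is applied on the product of Borel measures, whereas weak solutions are only
  Lebesgue measurable.  The next lemmas allow a solution to be replaced by a Borel representative.
\<close>
lemma AE_lborel_pair:
  fixes P :: "'a::euclidean_space \<Rightarrow> bool"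
  assumes "AE x in lborel. P x"
  shows "AE z in (lborel :: ('a \<times> 'a) measure). P (fst z) \<and> P (snd z)"
proof -
  obtain N where N: "N \<in> null_sets lborel" "{x. \<not> P x} \<subseteq> N"
    using assms by (auto simp: eventually_ae_filter)
  have "N \<times> UNIV \<in> null_sets (lborel \<Otimes>\<^sub>M lborel)" "UNIV \<times> N \<in> null_sets (lborel \<Otimes>\<^sub>M lborel)"
    using N(1) by (auto simp: null_sets_def lborel.emeasure_pair_measure_Times)
  then have "N \<times> UNIV \<union> UNIV \<times> N \<in> null_sets (lborel :: ('a \<times> 'a) measure)"
    unfolding lborel_prod by (rule null_sets.Un)
  from AE_not_in[OF this] show ?thesis by eventually_elim (use N(2) in \<open>auto simp: mem_Times_iff\<close>)
qed

lemma J_slog_cong_AE: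
  fixes u u' v :: "'a::euclidean_space \<Rightarrow> real"
  assumes ae: "AE x in lborel. u x = u' x"
    and meas: "u' \<in> borel_measurable borel" "v \<in> borel_measurable borel"
  shows "J_slog s p u v = J_slog s p u' v"
proof -
  have "energy p k u v = energy p k u' v" if k: "k \<in> borel_measurable borel" for k :: "'a \<Rightarrow> real"
  proof -
    let ?F = "\<lambda>u. \<lambda>(x, y). \<bar>u x - u y\<bar> powr (p - 2) * (u x - u y) * (v x - v y) * k (x - y)"
    have eq: "AE z in lebesgue. ?F u' z = ?F u z"
      by (rule AE_completion) (use AE_lborel_pair[OF ae] in \<open>auto simp: case_prod_unfold\<close>)
    have m: "?F u' \<in> borel_measurable lebesgue"
      using energy_integrand_measurable[OF meas k] by (rule measurable_completion)
    show ?thesis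
      unfolding energy_def using borel_measurable_AE[OF m eq] m eq
      by (intro integral_cong_AE) auto
  qed
  then show ?thesis by (simp add: J_slog_def)
qed

lemma J_slog_minus: "J_slog s p (\<lambda>x. - u x) v = - J_slog s p u v"
proof -
  have "energy p k (\<lambda>x. - u x) v = - energy p k u v" for k
  proof -
    have "\<bar>- u x - - u y\<bar> powr (p - 2) * (- u x - - u y) * (v x - v y) * k (x - y)
        = - (\<bar>u x - u y\<bar> powr (p - 2) * (u x - u y) * (v x - v y) * k (x - y))" for x y
      by (simp add: abs_minus_commute algebra_simps)
    then show ?thesis
      unfolding energy_def by (simp only: case_prod_unfold integral_minus)
  qed
  then show ?thesis by (simp add: J_slog_def algebra_simps)
qed

lemma W0_slog_minus:
  assumes "u \<in> W0_slog s p \<Omega>"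
  shows "(\<lambda>x. - u x) \<in> W0_slog s p \<Omega>"
proof -
  have "\<bar>u y - u x\<bar> = \<bar>u x - u y\<bar>" for x y by simp
  then show ?thesis using assms by (auto simp: W0_slog_def Lp_space_def)
qed

text \<open>
  Passing to a Borel representative \<open>v\<close> that vanishes everywhere outside \<open>\<Omega>\<close>.  Its
  truncations at levels \<open>k \<ge> 0\<close> are admissible test functions because truncation decreases both the
  norm and the energy.
\<close>
lemma weak_solution_bounded_above:
  fixes \<Omega> :: "'a::euclidean_space set" and u :: "'a \<Rightarrow> real"
  assumes p: "1 < p" and s: "0 < s" "s < 1" and B: "0 \<le> B_const DIM('a) s p"
    and Om: "open \<Omega>" "bounded \<Omega>" "diameter \<Omega> \<le> 1"
    and W: "u \<in> W0_slog s p \<Omega>"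
    and sol: "\<forall>\<phi> \<in> W0_slog s p \<Omega>.
      J_slog s p u \<phi> = lam * (LINT x:\<Omega>|lebesgue. \<bar>u x\<bar> powr (p - 2) * u x * \<phi> x)"
  shows "\<exists>k\<ge>0. AE x in lebesgue. u x \<le> k"
proof -
  have u_meas: "u \<in> borel_measurable lebesgue"
    and u_int: "integrable lebesgue (\<lambda>x. \<bar>u x\<bar> powr p)"
    and u_supp: "AE x in lborel. x \<notin> \<Omega> \<longrightarrow> u x = 0"
    and u_fin: "(\<integral>\<^sup>+ (x, y). ennreal (\<bar>u x - u y\<bar> powr p * kernel_log_pos s p (x - y))
       \<partial>(lborel :: ('a \<times> 'a) measure)) < \<infinity>"
    using W by (auto simp: W0_slog_def Lp_space_def AE_completion_iff nn_integral_completion)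
  obtain g where g [measurable]: "g \<in> borel_measurable borel" and ug: "AE x in lborel. u x = g x"
    using completion_ex_borel_measurable_real[OF u_meas] by auto
  have [measurable]: "\<Omega> \<in> sets borel" using Om(1) by simp
  define v where "v x = (if x \<in> \<Omega> then g x else 0)" for x
  have v [measurable]: "v \<in> borel_measurable borel"
    unfolding v_def[abs_def] by measurable
  have uv: "AE x in lborel. u x = v x"
    using ug u_supp by eventually_elim (auto simp: v_def)
  have supp: "v x = 0" if "x \<notin> \<Omega>" for x using that by (simp add: v_def)
  have K: "0 \<le> kernel_log_pos s p z" for z :: 'a
    using C_const_pos[of s p "DIM('a)"] s p by (simp add: kernel_log_pos_def)
  have v_int: "integrable lborel (\<lambda>x. \<bar>v x\<bar> powr p)"
  proof -
    have "(\<integral>\<^sup>+ x. ennreal (\<bar>v x\<bar> powr p) \<partial>lborel) = (\<integral>\<^sup>+ x. ennreal (\<bar>u x\<bar> powr p) \<partial>lborel)"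
      using uv by (intro nn_integral_cong_AE) auto
    also have "\<dots> < \<infinity>"
      using u_int by (simp add: integrable_iff_bounded nn_integral_completion)
    finally show ?thesis by (intro integrableI_nonneg) auto
  qed
  have v_fin: "(\<integral>\<^sup>+ (x, y). ennreal (\<bar>v x - v y\<bar> powr p * kernel_log_pos s p (x - y))
       \<partial>(lborel :: ('a \<times> 'a) measure)) < \<infinity>"
  proof -
    have "(\<integral>\<^sup>+ (x, y). ennreal (\<bar>v x - v y\<bar> powr p * kernel_log_pos s p (x - y))
          \<partial>(lborel :: ('a \<times> 'a) measure))
        = (\<integral>\<^sup>+ (x, y). ennreal (\<bar>u x - u y\<bar> powr p * kernel_log_pos s p (x - y)) \<partial>lborel)"
      using AE_lborel_pair[OF uv] by (intro nn_integral_cong_AE) (auto simp: case_prod_unfold)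
    then show ?thesis using u_fin by simp
  qed
  have "\<exists>k\<ge>0. AE x in lborel. v x \<le> k"
  proof (rule borel_solution_bounded_above[OF p s B Om(2,3) v supp v_int v_fin])
    fix k :: real assume k: "0 \<le> k"
    let ?w = "\<lambda>x. max 0 (v x - k)"
    have w: "?w \<in> borel_measurable borel" by measurable
    have "?w \<in> W0_slog s p \<Omega>"
    proof -
      have "integrable lborel (\<lambda>x. \<bar>?w x\<bar> powr p)"
        using k p by (intro Bochner_Integration.integrable_bound[OF v_int]) (auto intro!: powr_mono2)
      then have "integrable lebesgue (\<lambda>x. \<bar>?w x\<bar> powr p)"
        by (subst integrable_completion) auto
      moreover have "(\<integral>\<^sup>+ (x, y). ennreal (\<bar>?w x - ?w y\<bar> powr p * kernel_log_pos s p (x - y))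
             \<partial>(lborel :: ('a \<times> 'a) measure))
          \<le> (\<integral>\<^sup>+ (x, y). ennreal (\<bar>v x - v y\<bar> powr p * kernel_log_pos s p (x - y)) \<partial>lborel)"
        using p K unfolding case_prod_unfold
        by (intro nn_integral_mono ennreal_leI mult_right_mono powr_mono2) auto
      ultimately show ?thesis
        using v_fin w k supp
        by (auto simp: W0_slog_def Lp_space_def nn_integral_completion measurable_completion
            intro: le_less_trans)
    qed
    then have "J_slog s p u ?w = lam * (LINT x:\<Omega>|lebesgue. \<bar>u x\<bar> powr (p - 2) * u x * ?w x)"
      using sol by blast
    also have "(LINT x:\<Omega>|lebesgue. \<bar>u x\<bar> powr (p - 2) * u x * ?w x)
        = (\<integral>x. \<bar>v x\<bar> powr (p - 2) * v x * ?w x \<partial>lebesgue)"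
    proof -
      have m: "(\<lambda>x. \<bar>v x\<bar> powr (p - 2) * v x * ?w x) \<in> borel_measurable lebesgue"
        by (intro measurable_completion) simp
      have e: "AE x in lebesgue. \<bar>v x\<bar> powr (p - 2) * v x * ?w x
          = indicator \<Omega> x *\<^sub>R (\<bar>u x\<bar> powr (p - 2) * u x * ?w x)"
        by (rule AE_completion, use uv in eventually_elim) (auto simp: supp split: split_indicator)
      show ?thesis
        unfolding set_lebesgue_integral_def
        using borel_measurable_AE[OF m e] m e by (intro integral_cong_AE) auto
    qed
    also have "\<dots> = (\<integral>x. \<bar>v x\<bar> powr (p - 2) * v x * ?w x \<partial>lborel)"
      by (intro integral_completion) simp
    finally show "J_slog s p v ?w = lam * (\<integral>x. \<bar>v x\<bar> powr (p - 2) * v x * ?w x \<partial>lborel)"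
      using J_slog_cong_AE[OF uv v w] by simp
  qed
  then obtain k where "0 \<le> k" "AE x in lborel. v x \<le> k" by auto
  moreover from this(2) uv have "AE x in lborel. u x \<le> k" by eventually_elim simp
  ultimately show ?thesis by (auto intro: AE_completion)
qed

section \<open>Boundedness of weak solutions\<close>
theorem theorem5p1:
  fixes \<Omega> :: "'a::euclidean_space set"
    and u :: "'a \<Rightarrow> real"
    and s p lam :: real
  assumes "1 < p"
    and "0 < s" and "s < 1"
    and "open \<Omega>" and "bounded \<Omega>" and "lipschitz_boundary \<Omega>"
    and "diameter \<Omega> < exp (- (1 / (s * p)))"
    and "B_const DIM('a) s p \<ge> 0"
    and "u \<in> W0_slog s p \<Omega>"
    and "\<forall>\<phi> \<in> W0_slog s p \<Omega>.
           J_slog s p u \<phi> = lam * (LINT x:\<Omega>|lebesgue. \<bar>u x\<bar> powr (p - 2) * u x * \<phi> x)"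
  shows "u \<in> Linf_space \<Omega>"
proof -
  have "exp (- (1 / (s * p))) \<le> (1::real)" using assms(1,2) by simp
  then have diam: "diameter \<Omega> \<le> 1" using assms(7) by linarith
  note bounded_above = weak_solution_bounded_above[OF assms(1-3,8,4,5) diam]
  obtain k where k: "AE x in lebesgue. u x \<le> k"
    using bounded_above[OF assms(9,10)] by blast
  have "\<forall>\<phi> \<in> W0_slog s p \<Omega>. J_slog s p (\<lambda>x. - u x) \<phi>
      = lam * (LINT x:\<Omega>|lebesgue. \<bar>- u x\<bar> powr (p - 2) * (- u x) * \<phi> x)"
    using assms(10) by (simp add: J_slog_minus set_lebesgue_integral_def)
  from bounded_above[OF W0_slog_minus[OF assms(9)] this]
  obtain l where l: "AE x in lebesgue. - u x \<le> l" by blast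
  from k l have "AE x in lebesgue. \<bar>u x\<bar> \<le> max k l" by eventually_elim auto
  then have "AE x in lebesgue_on \<Omega>. \<bar>u x\<bar> \<le> max k l"
    using assms(4) by (subst AE_restrict_space_iff) auto
  moreover have "u \<in> borel_measurable (lebesgue_on \<Omega>)"
    using assms(9) by (auto simp: W0_slog_def Lp_space_def intro: measurable_restrict_space1)
  ultimately show ?thesis by (auto simp: Linf_space_def)
qed

end
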